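(* Let $K$ be a field of characteristic $0$ and $\mathbf{x}=x_1,x_2,\dots$ variables. In the algebra $\bigoplus_{n\ge0}K[[x_1,\dots,x_n]]S_n$ with product $\star$, the element \[ \Theta(\mathbf{x})=\sum_{n\ge0}\sum_{\sigma\in S_n}\frac{\prod_{j\in D(\sigma)}x_{\sigma(1)}x_{\sigma(2)}\cdots x_{\sigma(j)}}{\prod_{i=1}^{n}(1-x_{\sigma(1)}x_{\sigma(2)}\cdots x_{\sigma(i)})}\,\sigma \] satisfies \[ \Theta(\mathbf{x})=\cdots\star F(2)\star F(1)\star F(0),\qquad F(m)=\varepsilon+x_1^m\,1+x_1^mx_2^m\,12+x_1^mx_2^mx_3^m\,123+\cdots, \] where the infinite product is expanded from right to left.
   Context: For $\sigma\in S_n$ (written as the word $\sigma(1)\cdots\sigma(n)$), $D(\sigma)=\{j:1\le j\le n-1,\ \sigma(j)>\sigma(j+1)\}$; $\varepsilon$ is the unique element of $S_0$, and $12\cdots a$ denotes the identity of $S_a$. Elements of $\bigoplus_{n\ge0}K[[x_1,\dots,x_n]]S_n$ are (possibly infinite in $n$) sums $\sum_n\sum_{\sigma\in S_n}f_\sigma\,\sigma$ with $f_\sigma\in K[[x_1,\dots,x_n]]$. For a word $w=w(1)\cdots w(n)$ with distinct letters in the positive integers, its standardization $\mathrm{st}(w)\in S_n$ is the unique permutation with $\mathrm{st}(w)(i)\le\mathrm{st}(w)(j)\iff w(i)\le w(j)$. If such $w$ has letters $a_1<\dots<a_n$ and $f\in K[[x_1,\dots,x_n]]$, set $f(w)=f(x_{a_1},\dots,x_{a_n})$.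 For $\sigma\in S_s$, $\tau\in S_t$, the set $\sigma\star\tau$ consists of all $w\in S_{s+t}$ with $\mathrm{st}(w(1)\cdots w(s))=\sigma$ and $\mathrm{st}(w(s+1)\cdots w(s+t))=\tau$, and \[ (f\sigma)\star(g\tau)=\sum_{w\in\sigma\star\tau}f(w(1)\cdots w(s))\,g(w(s+1)\cdots w(s+t))\,w, \] extended bilinearly; this is associative. The infinite product $\cdots\star F(2)\star F(1)\star F(0)$ is the limit of the finite products $F(M)\star\cdots\star F(1)\star F(0)$ as $M\to\infty$, which exists coefficientwise since $F(m)-\varepsilon$ has all coefficients of total degree at least $m$. *)

theory Defs
  imports "HOL-Library.Poly_Mapping" "HOL-Combinatorics.Multiset_Permutations"
begin

section \<open>Formal power series in the variables $x_0, x_1, x_2, \dots$\<close>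

text \<open>
  A power series is the family of its coefficients, indexed by finitely supported exponent
  vectors. The ring $K[[x_1,\dots,x_n]]$ is the subring \<open>series_in {1..n}\<close> below; the variable
  with index 0 is never used.
\<close>

typedef 'a mfps = "UNIV :: ((nat \<Rightarrow>\<^sub>0 nat) \<Rightarrow> 'a) set"
  morphisms mcoeff Abs_mfps ..

setup_lifting type_definition_mfps

lemma mfps_eqI: "(\<And>m. mcoeff f m = mcoeff g m) \<Longrightarrow> f = g"
  by transfer auto

lemma finite_antidiagonal_pm: "finite {(a, b). a + b = (m :: nat \<Rightarrow>\<^sub>0 nat)}"
proof -
  have "finite {a :: nat \<Rightarrow>\<^sub>0 nat. \<forall>k. Poly_Mapping.lookup a k \<le> Poly_Mapping.lookup m k}" (is "finite ?A")
  proof (rule finite_imageD)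
    have "(\<lambda>a. restrict (Poly_Mapping.lookup a) (Poly_Mapping.keys m)) ` ?A \<subseteq> (PiE (Poly_Mapping.keys m) (\<lambda>k. {..Poly_Mapping.lookup m k}))"
      by auto
    then show "finite ((\<lambda>a. restrict (Poly_Mapping.lookup a) (Poly_Mapping.keys m)) ` ?A)"
      by (rule finite_subset) (auto intro!: finite_PiE)
    show "inj_on (\<lambda>a. restrict (Poly_Mapping.lookup a) (Poly_Mapping.keys m)) ?A"
    proof (rule inj_onI)
      fix a b assume a: "a \<in> ?A" and b: "b \<in> ?A"
        and eq: "restrict (Poly_Mapping.lookup a) (Poly_Mapping.keys m) = restrict (Poly_Mapping.lookup b) (Poly_Mapping.keys m)"
      show "a = b"
      proof (rule poly_mapping_eqI)
        fix k
        show "Poly_Mapping.lookup a k = Poly_Mapping.lookup b k"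
        proof (cases "k \<in> Poly_Mapping.keys m")
          case True
          with eq show ?thesis by (metis restrict_apply')
        next
          case False
          then have "Poly_Mapping.lookup m k = 0" by (simp add: in_keys_iff)
          with a b show ?thesis by (metis le_zero_eq mem_Collect_eq)
        qed
      qed
    qed
  qed
  then have "finite ((\<lambda>a. (a, m - a)) ` ?A)" by simp
  moreover have "{(a, b). a + b = m} \<subseteq> (\<lambda>a. (a, m - a)) ` ?A"
    by (auto simp: lookup_add)
  ultimately show ?thesis by (rule finite_subset[rotated])
qed

instantiation mfps :: (comm_ring_1) comm_ring_1
begin

lift_definition zero_mfps :: "'a mfps" is "\<lambda>_. 0" .
lift_definition one_mfps :: "'a mfps" is "\<lambda>m. if m = 0 then 1 else 0" .
lift_definition plus_mfps :: "'a mfps \<Rightarrow> 'a mfps \<Rightarrow> 'a mfps" is "\<lambda>f g m. f m + g m" .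
lift_definition minus_mfps :: "'a mfps \<Rightarrow> 'a mfps \<Rightarrow> 'a mfps" is "\<lambda>f g m. f m - g m" .
lift_definition uminus_mfps :: "'a mfps \<Rightarrow> 'a mfps" is "\<lambda>f m. - f m" .
lift_definition times_mfps :: "'a mfps \<Rightarrow> 'a mfps \<Rightarrow> 'a mfps"
  is "\<lambda>f g m. \<Sum>(a, b) | a + b = m. f a * g b" .

instance
proof
  fix f g h :: "'a mfps"
  show "f * g * h = f * (g * h)"
  proof (rule mfps_eqI)
    fix m
    have "mcoeff (f * g * h) m
        = (\<Sum>(p, q) | p + q = m. \<Sum>(a, b) | a + b = p. mcoeff f a * mcoeff g b * mcoeff h q)"
      by (simp add: times_mfps.rep_eq sum_distrib_right case_prod_beta)
    also have "\<dots> = (\<Sum>((p, q), (a, b)) \<in> Sigma {(p, q). p + q = m} (\<lambda>(p, q). {(a, b). a + b = p}).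
        mcoeff f a * mcoeff g b * mcoeff h q)"
      by (subst sum.Sigma[symmetric])
         (auto simp: finite_antidiagonal_pm case_prod_beta intro!: sum.cong)
    also have "\<dots> = (\<Sum>((a, r), (b, q)) \<in> Sigma {(a, r). a + r = m} (\<lambda>(a, r). {(b, q). b + q = r}).
        mcoeff f a * (mcoeff g b * mcoeff h q))"
      by (rule sum.reindex_bij_witness[where
            i = "\<lambda>((a, r), (b, q)). ((a + b, q), (a, b))" and
            j = "\<lambda>((p, q), (a, b)). ((a, b + q), (b, q))"])
         (auto simp: algebra_simps)
    also have "\<dots> = (\<Sum>(a, r) | a + r = m. \<Sum>(b, q) | b + q = r. mcoeff f a * (mcoeff g b * mcoeff h q))"
      by (subst sum.Sigma[symmetric])
         (auto simp: finite_antidiagonal_pm case_prod_beta intro!: sum.cong)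
    also have "\<dots> = mcoeff (f * (g * h)) m"
      by (simp add: times_mfps.rep_eq sum_distrib_left case_prod_beta)
    finally show "mcoeff (f * g * h) m = mcoeff (f * (g * h)) m" .
  qed
  show "f * g = g * f"
  proof (rule mfps_eqI)
    fix m
    show "mcoeff (f * g) m = mcoeff (g * f) m"
      unfolding times_mfps.rep_eq
      by (rule sum.reindex_bij_witness[where i = prod.swap and j = prod.swap])
         (auto simp: algebra_simps)
  qed
  show "1 * f = f"
  proof (rule mfps_eqI)
    fix m
    have "mcoeff (1 * f) m = (\<Sum>x \<in> {(a, b). a + b = m}. if x = (0, m) then mcoeff f m else 0)"
      unfolding times_mfps.rep_eq one_mfps.rep_eq by (rule sum.cong) (auto split: if_splits)
    also have "\<dots> = mcoeff f m"
      by (simp add: finite_antidiagonal_pm)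
    finally show "mcoeff (1 * f) m = mcoeff f m" .
  qed
  show "(f + g) * h = f * h + g * h"
    by (rule mfps_eqI)
       (simp add: times_mfps.rep_eq plus_mfps.rep_eq algebra_simps sum.distrib case_prod_beta)
  show "(0 :: 'a mfps) \<noteq> 1"
    by transfer (metis zero_neq_one)
qed (transfer; simp add: algebra_simps fun_eq_iff)+

end

text \<open>
  Division is multiplication by the ring-theoretic inverse, which is unique whenever it exists
  (and junk otherwise).
\<close>

instantiation mfps :: (field) inverse
begin

definition inverse_mfps :: "'a mfps \<Rightarrow> 'a mfps" where
  "inverse_mfps f = (THE g. f * g = 1)"

definition divide_mfps :: "'a mfps \<Rightarrow> 'a mfps \<Rightarrow> 'a mfps" where
  "divide_mfps f g = f * inverse g"

instance ..

end

lemma inverse_mfps_unique: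
  fixes f g :: "'a :: field mfps"
  assumes "f * g = 1"
  shows "inverse f = g"
  unfolding inverse_mfps_def
proof (rule the_equality)
  fix h assume "f * h = 1"
  then show "h = g"
    using assms by (metis mult.assoc mult.commute mult_1_left)
qed (fact assms)

lemma mcoeff_sum_mfps: "mcoeff (sum f A) m = (\<Sum>x\<in>A. mcoeff (f x) m)"
  by (induction A rule: infinite_finite_induct) (simp_all add: zero_mfps.rep_eq plus_mfps.rep_eq)

lemma mult_inverse_mfps:
  fixes f :: "'a :: field mfps"
  assumes f0: "mcoeff f 0 \<noteq> 0"
  shows "f * inverse f = 1"
proof -
  define d where "d m = (\<Sum>k\<in>Poly_Mapping.keys m. Poly_Mapping.lookup m k)" for m :: "nat \<Rightarrow>\<^sub>0 nat"
  have d_alt: "d m = (\<Sum>k\<in>A. Poly_Mapping.lookup m k)"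
    if "finite A" "Poly_Mapping.keys m \<subseteq> A" for A m
    unfolding d_def using that by (intro sum.mono_neutral_left) (auto simp: in_keys_iff)
  have d_add: "d (a + b) = d a + d b" for a b
  proof -
    let ?A = "Poly_Mapping.keys a \<union> Poly_Mapping.keys b"
    have "d (a + b) = (\<Sum>k\<in>?A. Poly_Mapping.lookup (a + b) k)"
      by (rule d_alt) (use keys_add[of a b] in auto)
    also have "\<dots> = d a + d b"
      by (simp add: d_alt[of ?A a] d_alt[of ?A b] lookup_add sum.distrib)
    finally show ?thesis .
  qed
  have d0: "a = 0" if "d a = 0" for a
    using that by (auto simp: d_def in_keys_iff intro!: poly_mapping_eqI)
  define c :: "'a mfps" where "c = Abs_mfps (\<lambda>m. if m = 0 then inverse (mcoeff f 0) else 0)"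
  have c: "mcoeff c m = (if m = 0 then inverse (mcoeff f 0) else 0)" for m
    unfolding c_def by (simp add: Abs_mfps_inverse)
  define u where "u = 1 - c * f"
  have "{(a, b). a + b = (0 :: nat \<Rightarrow>\<^sub>0 nat)} = {(0, 0)}"
    by (auto simp: poly_mapping_eq_iff lookup_add fun_eq_iff)
  then have u0: "mcoeff u 0 = 0"
    using f0 by (simp add: u_def minus_mfps.rep_eq one_mfps.rep_eq times_mfps.rep_eq c)
  have low: "mcoeff (u ^ n) m = 0" if "d m < n" for n m
    using that
  proof (induction n arbitrary: m)
    case (Suc n)
    have "mcoeff u a * mcoeff (u ^ n) b = 0" if "a + b = m" for a b
    proof (cases "a = 0")
      case False
      then have "0 < d a" using d0[of a] by blast
      moreover have "d m = d a + d b" using d_add that by blast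
      ultimately have "d b < n" using Suc.prems by linarith
      then show ?thesis using Suc.IH by simp
    qed (simp add: u0)
    then show ?case by (auto simp: times_mfps.rep_eq intro!: sum.neutral)
  qed simp
  define g where "g = Abs_mfps (\<lambda>m. mcoeff (\<Sum>k\<le>d m. u ^ k) m)"
  have g: "mcoeff g m = mcoeff (\<Sum>k\<le>N. u ^ k) m" if "d m \<le> N" for m N
  proof -
    have "mcoeff g m = (\<Sum>k\<le>d m. mcoeff (u ^ k) m)"
      by (simp add: g_def Abs_mfps_inverse mcoeff_sum_mfps)
    also have "\<dots> = (\<Sum>k\<le>N. mcoeff (u ^ k) m)"
      using that low by (intro sum.mono_neutral_left) auto
    finally show ?thesis by (simp add: mcoeff_sum_mfps)
  qed
  have geo: "(1 - u) * (\<Sum>k\<le>N. u ^ k) = 1 - u ^ Suc N" for N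
  proof (induction N)
    case (Suc N)
    have "(1 - u) * (\<Sum>k\<le>Suc N. u ^ k) = (1 - u) * (\<Sum>k\<le>N. u ^ k) + (1 - u) * u ^ Suc N"
      by (simp only: sum.atMost_Suc distrib_left)
    also have "\<dots> = 1 - u ^ Suc (Suc N)"
      unfolding Suc.IH by (simp add: left_diff_distrib)
    finally show ?case .
  qed simp
  have "(1 - u) * g = 1"
  proof (rule mfps_eqI)
    fix m
    have "mcoeff ((1 - u) * g) m = mcoeff ((1 - u) * (\<Sum>k\<le>d m. u ^ k)) m"
      unfolding times_mfps.rep_eq by (rule sum.cong) (auto simp: d_add g)
    also have "(1 - u) * (\<Sum>k\<le>d m. u ^ k) = 1 - u ^ Suc (d m)"
      by (rule geo)
    also have "mcoeff \<dots> m = mcoeff 1 m"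
      using low[of m "Suc (d m)"] by (simp add: minus_mfps.rep_eq)
    finally show "mcoeff ((1 - u) * g) m = mcoeff 1 m" .
  qed
  then have "f * (c * g) = 1" by (simp add: u_def mult_ac)
  then show ?thesis using inverse_mfps_unique by metis
qed

lift_definition X :: "nat \<Rightarrow> 'a :: comm_ring_1 mfps"
  is "\<lambda>i m. if m = Poly_Mapping.single i 1 then 1 else 0" .

definition series_in :: "nat set \<Rightarrow> 'a :: comm_ring_1 mfps set" where
  "series_in A = {f. \<forall>m. mcoeff f m \<noteq> 0 \<longrightarrow> Poly_Mapping.keys m \<subseteq> A}"

section \<open>Words and permutations\<close>

text \<open>Words are lists; \<open>letter w i\<close> is $w(i)$, with positions counted from 1.\<close>

definition letter :: "nat list \<Rightarrow> nat \<Rightarrow> nat" where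
  "letter w i = w ! (i - 1)"

abbreviation perms :: "nat \<Rightarrow> nat list set" where
  "perms n \<equiv> permutations_of_set {1..n}"

definition descents :: "nat list \<Rightarrow> nat set" where
  "descents w = {j. 1 \<le> j \<and> j \<le> length w - 1 \<and> letter w j > letter w (j + 1)}"

definition st :: "nat list \<Rightarrow> nat list" where
  "st w = (THE p. p \<in> perms (length w) \<and>
     (\<forall>i\<in>{1..length w}. \<forall>j\<in>{1..length w}. letter p i \<le> letter p j \<longleftrightarrow> letter w i \<le> letter w j))"

definition star_words :: "nat list \<Rightarrow> nat list \<Rightarrow> nat list set" where
  "star_words \<sigma> \<tau> = {w \<in> perms (length \<sigma> + length \<tau>).
     st (take (length \<sigma>) w) = \<sigma> \<and> st (drop (length \<sigma>) w) = \<tau>}"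

text \<open>
  \<open>at_word f w\<close> is $f(w) = f(x_{a_1},\dots,x_{a_n})$, where $a_1<\dots<a_n$ are the letters of \<open>w\<close>
  and $f\in K[[x_1,\dots,x_n]]$: a monomial $\prod_i x_{a_i}^{e_i}$ in the variables $x_{a_i}$
  receives the coefficient of $\prod_i x_i^{e_i}$ in \<open>f\<close>, all other monomials receive 0.
\<close>

lift_definition at_word :: "'a :: comm_ring_1 mfps \<Rightarrow> nat list \<Rightarrow> 'a mfps"
  is "\<lambda>f w m. if Poly_Mapping.keys m \<subseteq> set w
              then f (\<Sum>i = 1..length w. Poly_Mapping.single i (Poly_Mapping.lookup m (letter (sort w) i)))
              else 0" .

lemma at_word_X:
  assumes "distinct w" "i \<in> {1..length w}"
  shows "at_word (X i) w = X (letter (sort w) i)"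
proof (rule mfps_eqI)
  fix m :: "nat \<Rightarrow>\<^sub>0 nat"
  let ?a = "letter (sort w)"
  let ?s = "\<Sum>k = 1..length w. Poly_Mapping.single k (Poly_Mapping.lookup m (?a k))"
  have a_in: "?a k \<in> set w" if "k \<in> {1..length w}" for k
  proof -
    have "k - 1 < length (sort w)" using that by auto
    then have "sort w ! (k - 1) \<in> set (sort w)" by (rule nth_mem)
    then show ?thesis by (simp add: letter_def)
  qed
  have a_inj: "?a k = ?a l \<longleftrightarrow> k = l" if "k \<in> {1..length w}" "l \<in> {1..length w}" for k l
    using that assms(1) by (auto simp: letter_def nth_eq_iff_index_eq)
  have a_surj: "\<exists>k\<in>{1..length w}. x = ?a k" if "x \<in> set w" for x
  proof -
    have "x \<in> set (sort w)" using that by simp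
    then obtain j where j: "j < length (sort w)" "sort w ! j = x"
      unfolding in_set_conv_nth by blast
    have "Suc j \<in> {1..length w}" "x = ?a (Suc j)" using j by (simp_all add: letter_def)
    then show ?thesis by blast
  qed
  have look: "Poly_Mapping.lookup ?s l = (if l \<in> {1..length w} then Poly_Mapping.lookup m (?a l) else 0)" for l
    by (simp add: lookup_sum lookup_single when_def)
  show "mcoeff (at_word (X i) w) m = mcoeff (X (?a i)) m"
  proof (cases "Poly_Mapping.keys m \<subseteq> set w")
    case True
    have "?s = Poly_Mapping.single i 1 \<longleftrightarrow> m = Poly_Mapping.single (?a i) 1"
    proof
      assume m: "m = Poly_Mapping.single (?a i) 1"
      show "?s = Poly_Mapping.single i 1"
      proof (rule poly_mapping_eqI)
        fix l
        show "Poly_Mapping.lookup ?s l = Poly_Mapping.lookup (Poly_Mapping.single i 1) l"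
          unfolding look unfolding m lookup_single using a_inj[of i l] assms(2) by (auto simp: when_def)
      qed
    next
      assume s: "?s = Poly_Mapping.single i 1"
      show "m = Poly_Mapping.single (?a i) 1"
      proof (rule poly_mapping_eqI)
        fix x
        show "Poly_Mapping.lookup m x = Poly_Mapping.lookup (Poly_Mapping.single (?a i) 1) x"
        proof (cases "x \<in> set w")
          case True
          then obtain k where k: "k \<in> {1..length w}" "x = ?a k" using a_surj by blast
          then have "Poly_Mapping.lookup m x = Poly_Mapping.lookup ?s k" unfolding look by simp
          then show ?thesis unfolding s using k a_inj assms by (auto simp: lookup_single when_def)
        next
          case False
          then have "Poly_Mapping.lookup m x = 0" using True by (auto simp: in_keys_iff)
          moreover have "?a i \<noteq> x" using False a_in assms by auto
          ultimately show ?thesis by (simp add: lookup_single)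
        qed
      qed
    qed
    then show ?thesis using True by (simp add: at_word.rep_eq X.rep_eq)
  next
    case False
    then have "m \<noteq> Poly_Mapping.single (?a i) 1" using a_in assms by auto
    then show ?thesis using False by (simp add: at_word.rep_eq X.rep_eq)
  qed
qed

section \<open>The algebra\<close>

text \<open>
  The formal sum $\sum_n\sum_{\sigma\in S_n} f_\sigma\,\sigma$ is the function
  $\sigma\mapsto f_\sigma$, extended by 0 to words that are not permutations.
\<close>

type_synonym 'a perm_series = "nat list \<Rightarrow> 'a mfps"

definition perm_algebra :: "'a :: comm_ring_1 perm_series set" where
  "perm_algebra = {F. (\<forall>n. \<forall>\<sigma>\<in>perms n. F \<sigma> \<in> series_in {1..n}) \<and>
                      (\<forall>w. (\<forall>n. w \<notin> perms n) \<longrightarrow> F w = 0)}"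

text \<open>
  The coefficient of \<open>w\<close> in the bilinear extension collects the contributions of all pairs of
  permutations $(\sigma,\tau)$ with $w\in\sigma\star\tau$; only sizes $s+t=|w|$ can contribute.
\<close>

definition star :: "'a :: comm_ring_1 perm_series \<Rightarrow> 'a perm_series \<Rightarrow> 'a perm_series"
    (infixr "\<star>" 70) where
  "(F \<star> G) w = (\<Sum>s\<le>length w. \<Sum>\<sigma>\<in>perms s. \<Sum>\<tau>\<in>perms (length w - s).
      if w \<in> star_words \<sigma> \<tau> then at_word (F \<sigma>) (take s w) * at_word (G \<tau>) (drop s w) else 0)"

fun star_partial :: "(nat \<Rightarrow> 'a :: comm_ring_1 perm_series) \<Rightarrow> nat \<Rightarrow> 'a perm_series" where
  "star_partial F 0 = F 0"
| "star_partial F (Suc M) = F (Suc M) \<star> star_partial F M"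

text \<open>
  Convergence of $F(M)\star\cdots\star F(1)\star F(0)$ to \<open>P\<close> as $M\to\infty$, coefficientwise:
  each coefficient of each monomial in each $f_\sigma$ is eventually constant.
\<close>

definition has_star_prod :: "(nat \<Rightarrow> 'a :: comm_ring_1 perm_series) \<Rightarrow> 'a perm_series \<Rightarrow> bool"
    (infix "has'_star'_prod" 50) where
  "F has_star_prod P \<longleftrightarrow>
     (\<forall>w m. eventually (\<lambda>M. mcoeff (star_partial F M w) m = mcoeff (P w) m) sequentially)"

definition Theta :: "'a :: field perm_series" where
  "Theta \<sigma> = (if \<sigma> \<in> perms (length \<sigma>)
     then (\<Prod>j\<in>descents \<sigma>. \<Prod>k=1..j. X (letter \<sigma> k)) /
          (\<Prod>i=1..length \<sigma>. 1 - (\<Prod>k=1..i. X (letter \<sigma> k)))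
     else 0)"

text \<open>
  $F(m)$ is supported on the identity permutations $12\cdots a$, $a\ge 0$; for $a=0$ this is
  $\varepsilon$, with coefficient the empty product.
\<close>

definition Fm :: "nat \<Rightarrow> 'a :: comm_ring_1 perm_series" where
  "Fm m \<sigma> = (if \<sigma> = [1..<Suc (length \<sigma>)] then \<Prod>i=1..length \<sigma>. X i ^ m else 0)"

section \<open>Consistency of the definitions\<close>

lemma st_exists_unique:
  assumes "distinct w"
  shows "\<exists>!p. p \<in> perms (length w) \<and>
     (\<forall>i\<in>{1..length w}. \<forall>j\<in>{1..length w}. letter p i \<le> letter p j \<longleftrightarrow> letter w i \<le> letter w j)"
    (is "\<exists>!p. ?P p")
proof -
  let ?n = "length w"
  define r where "r i = card {j \<in> {..<?n}. w ! j \<le> w ! i}" for i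
  have idx: "(\<forall>i\<in>{1..?n}. \<forall>j\<in>{1..?n}. letter p i \<le> letter p j \<longleftrightarrow> letter w i \<le> letter w j)
     \<longleftrightarrow> (\<forall>i<?n. \<forall>j<?n. p ! i \<le> p ! j \<longleftrightarrow> w ! i \<le> w ! j)" for p
  proof -
    have "(\<forall>i\<in>{1..?n}. \<forall>j\<in>{1..?n}. letter p i \<le> letter p j \<longleftrightarrow> letter w i \<le> letter w j)
       \<longleftrightarrow> (\<forall>i\<in>Suc ` {..<?n}. \<forall>j\<in>Suc ` {..<?n}. letter p i \<le> letter p j \<longleftrightarrow> letter w i \<le> letter w j)"
      by (simp add: image_Suc_lessThan)
    then show ?thesis by (simp only: letter_def ball_simps lessThan_iff Ball_def[of "{..<?n}"] diff_Suc_1)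
  qed
  have r_mono: "r i \<le> r j \<longleftrightarrow> w ! i \<le> w ! j" if "i < ?n" "j < ?n" for i j
  proof
    assume "w ! i \<le> w ! j"
    then show "r i \<le> r j" unfolding r_def by (intro card_mono) auto
  next
    assume le: "r i \<le> r j"
    show "w ! i \<le> w ! j"
    proof (rule ccontr)
      assume "\<not> w ! i \<le> w ! j"
      then have "{k \<in> {..<?n}. w ! k \<le> w ! j} \<subset> {k \<in> {..<?n}. w ! k \<le> w ! i}"
        using that by auto
      then have "r j < r i" unfolding r_def by (intro psubset_card_mono) auto
      with le show False by simp
    qed
  qed
  have inj: "inj_on r {..<?n}"
    by (rule inj_onI) (metis assms lessThan_iff nth_eq_iff_index_eq order_antisym_conv order_refl r_mono)
  have sub: "r ` {..<?n} \<subseteq> {1..?n}"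
  proof
    fix x assume "x \<in> r ` {..<?n}"
    then obtain i where i: "i < ?n" "x = r i" by auto
    have "card {j \<in> {..<?n}. w ! j \<le> w ! i} \<le> card {..<?n}" by (intro card_mono) auto
    moreover have "0 < card {j \<in> {..<?n}. w ! j \<le> w ! i}"
      using i by (subst card_gt_0_iff) auto
    ultimately show "x \<in> {1..?n}" using i by (simp add: r_def)
  qed
  have img: "r ` {..<?n} = {1..?n}"
    using sub inj by (intro card_subset_eq) (auto simp: card_image)
  let ?q = "map r [0..<?n]"
  have Pq: "?P ?q"
    unfolding idx using inj img r_mono
    by (auto simp: permutations_of_set_def distinct_map atLeast0LessThan)
  moreover have "p = ?q" if P: "?P p" for p
  proof (rule nth_equalityI)
    have p: "set p = {1..?n}" "distinct p" using P by (auto simp: permutations_of_set_def)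
    then show len: "length p = length ?q" using distinct_card by fastforce
    fix i assume "i < length p"
    with len have i: "i < ?n" by simp
    have "p ! i \<in> {1..?n}" using p i len by (metis length_map length_upt minus_nat.diff_0 nth_mem)
    then have "{x \<in> set p. x \<le> p ! i} = {1..p ! i}" using p by auto
    then have "p ! i = card {x \<in> set p. x \<le> p ! i}" by simp
    also have "{x \<in> set p. x \<le> p ! i} = (\<lambda>j. p ! j) ` {j \<in> {..<?n}. w ! j \<le> w ! i}"
      using P[unfolded idx] i len by (auto simp: in_set_conv_nth)
    also have "card \<dots> = r i"
      unfolding r_def using p len by (intro card_image) (auto simp: inj_on_def nth_eq_iff_index_eq)
    finally show "p ! i = ?q ! i" using i by simp
  qed
  ultimately show ?thesis by blast
qed

text \<open>The product of two one-term sums is the one in the definition of $\star$.\<close>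

lemma star_single:
  assumes "\<sigma> \<in> perms s" "\<tau> \<in> perms t"
  shows "((\<lambda>_. 0)(\<sigma> := f) \<star> (\<lambda>_. 0)(\<tau> := g)) w
       = (if w \<in> star_words \<sigma> \<tau> then at_word f (take s w) * at_word g (drop s w) else 0)"
proof -
  have len: "length p = n" if "p \<in> perms n" for p n
    using that distinct_card[of p] by (auto simp: permutations_of_set_def)
  have at0: "at_word 0 v = 0" for v
    by transfer auto
  have fin: "finite (perms n)" for n by simp
  have uniq: "p \<in> perms n \<Longrightarrow> p = \<sigma> \<Longrightarrow> n = s" "p \<in> perms n \<Longrightarrow> p = \<tau> \<Longrightarrow> n = t" for p n
    using assms len by metis+
  show ?thesis
  proof (cases "w \<in> star_words \<sigma> \<tau>")
    case True
    then have lw: "length w = s + t"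
      using len[OF assms(1)] len[OF assms(2)] len by (auto simp: star_words_def)
    have "((\<lambda>_. 0)(\<sigma> := f) \<star> (\<lambda>_. 0)(\<tau> := g)) w
        = (\<Sum>k\<le>length w. if k = s then \<Sum>p\<in>perms s. if p = \<sigma> then
             (\<Sum>q\<in>perms t. if q = \<tau> then at_word f (take s w) * at_word g (drop s w) else 0)
             else 0 else 0)"
      unfolding star_def
    proof (intro sum.cong refl, goal_cases)
      case (1 k)
      show ?case
      proof (cases "k = s")
        case k: True
        then have "(if w \<in> star_words p q then at_word (((\<lambda>_. 0)(\<sigma> := f)) p) (take k w) *
            at_word (((\<lambda>_. 0)(\<tau> := g)) q) (drop k w) else 0)
          = (if p = \<sigma> then if q = \<tau> then at_word f (take s w) * at_word g (drop s w) else 0 else 0)"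
          for p q using True by (simp add: at0)
        moreover have "length w - k = t" using k lw by simp
        ultimately show ?thesis
          using k by (simp only: simp_thms if_True) (intro sum.cong refl, simp)
      next
        case False
        then have "p \<noteq> \<sigma>" if "p \<in> perms k" for p using uniq that by blast
        then show ?thesis using False by (auto intro!: sum.neutral simp: at0)
      qed
    qed
    also have "\<dots> = at_word f (take s w) * at_word g (drop s w)"
      using assms lw by simp
    finally show ?thesis using True by simp
  next
    case False
    then have "((\<lambda>_. 0)(\<sigma> := f) \<star> (\<lambda>_. 0)(\<tau> := g)) w = 0"
      unfolding star_def by (intro sum.neutral ballI) (auto simp: at0)
    then show ?thesis using False by simp
  qed
qed

end

theory Submission
  imports Defs
begin

text \<open>
  All coefficients involved are 0 or 1. For a permutation \<open>\<sigma>\<close>, expanding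
  $F(M)\star\cdots\star F(0)$ cuts \<open>\<sigma>\<close> into increasing blocks and gives all letters
  of the block coming from $F(m)$ the exponent \<open>m\<close>. Hence the coefficient of \<open>\<sigma>\<close> is the sum
  of the monomials $\prod_j x_{\sigma(j)}^{c_j}$ with $M\ge c_1\ge\dots\ge c_n\ge0$ and
  $c_j>c_{j+1}$ at every descent \<open>j\<close>. As \<open>M\<close> grows this becomes the generating function of all
  \<open>\<sigma>\<close>-partitions, and peeling off the last letter of \<open>\<sigma>\<close> evaluates it as the coefficient of
  \<open>\<Theta>\<close>.
\<close>

section \<open>Monomials\<close>

definition mono_series :: "(nat \<Rightarrow>\<^sub>0 nat) \<Rightarrow> 'a :: comm_ring_1 mfps" where
  "mono_series e = Abs_mfps (\<lambda>m. if m = e then 1 else 0)"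

lemma mcoeff_mono_series: "mcoeff (mono_series e) m = (if m = e then 1 else 0)"
  by (simp add: mono_series_def Abs_mfps_inverse)

lemma X_eq_mono_series: "X i = mono_series (Poly_Mapping.single i 1)"
  by (rule mfps_eqI) (simp add: X.rep_eq mcoeff_mono_series)

lemma one_eq_mono_series: "1 = mono_series 0"
  by (rule mfps_eqI) (simp add: one_mfps.rep_eq mcoeff_mono_series)

text \<open>Only the pair \<open>(e, m - e)\<close> survives in the convolution. Subtraction of
  exponent vectors is truncated, so the divisibility test has to be stated explicitly.\<close>

lemma mcoeff_mono_series_times:
  "mcoeff (mono_series e * f) m
     = (if \<forall>k. Poly_Mapping.lookup e k \<le> Poly_Mapping.lookup m k then mcoeff f (m - e) else 0)"
proof -
  have "mcoeff (mono_series e * f) m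
      = (\<Sum>x\<in>{(a, b). a + b = m}. if fst x = e then mcoeff f (snd x) else 0)"
    unfolding times_mfps.rep_eq by (intro sum.cong) (auto simp: mcoeff_mono_series)
  also have "\<dots> = (\<Sum>x\<in>{x \<in> {(a, b). a + b = m}. fst x = e}. mcoeff f (snd x))"
    by (subst sum.inter_filter) (auto simp: finite_antidiagonal_pm)
  also have "{x \<in> {(a, b). a + b = m}. fst x = e}
      = (if \<forall>k. Poly_Mapping.lookup e k \<le> Poly_Mapping.lookup m k then {(e, m - e)} else {})"
    by (auto simp: lookup_add lookup_minus intro!: poly_mapping_eqI)
  finally show ?thesis by simp
qed

lemma mono_series_times: "mono_series a * mono_series b = mono_series (a + b)"
proof (rule mfps_eqI)
  fix m
  have "(\<forall>k. Poly_Mapping.lookup a k \<le> Poly_Mapping.lookup m k) \<and> m - a = b \<longleftrightarrow> m = a + b"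
    by (auto simp: lookup_add lookup_minus intro!: poly_mapping_eqI)
  then show "mcoeff (mono_series a * mono_series b) m = (mcoeff (mono_series (a + b)) m :: 'a)"
    by (auto simp: mcoeff_mono_series_times mcoeff_mono_series)
qed

lemma mono_series_prod: "(\<Prod>i\<in>A. mono_series (e i)) = mono_series (\<Sum>i\<in>A. e i)"
  by (induction A rule: infinite_finite_induct)
     (simp_all add: one_eq_mono_series mono_series_times)

lemma X_power: "X i ^ k = mono_series (Poly_Mapping.single i k)"
  by (induction k)
     (simp_all add: one_eq_mono_series X_eq_mono_series mono_series_times single_add[symmetric])

lemma lookup_sum_single:
  assumes "finite A"
  shows "Poly_Mapping.lookup (\<Sum>a\<in>A. Poly_Mapping.single a (f a)) x = (if x \<in> A then f x else 0)"
  using assms by (simp add: lookup_sum lookup_single when_def)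

text \<open>Distinct letters make positions and letters correspond bijectively, so the product is a
  squarefree monomial depending only on the letter set.\<close>

lemma prod_letters:
  assumes "distinct w"
  shows "(\<Prod>k = 1..length w. X (letter w k)) = mono_series (\<Sum>a\<in>set w. Poly_Mapping.single a 1)"
proof -
  have "bij_betw (\<lambda>k. w ! (k - 1)) {1..length w} (set w)"
  proof (rule bij_betwI')
    fix y assume "y \<in> set w"
    then obtain j where "j < length w" "y = w ! j" by (auto simp: in_set_conv_nth)
    then show "\<exists>k\<in>{1..length w}. y = w ! (k - 1)" by (intro bexI[of _ "Suc j"]) auto
  qed (use assms in \<open>auto simp: nth_eq_iff_index_eq\<close>)
  then have "(\<Prod>k = 1..length w. X (letter w k)) = (\<Prod>a\<in>set w. X a)"
    unfolding letter_def by (rule prod.reindex_bij_betw)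
  then show ?thesis by (simp only: X_eq_mono_series mono_series_prod)
qed

section \<open>Generating functions of \<open>P\<close>-partitions\<close>

text \<open>
  For a word with distinct letters, being sorted with respect to \<open>part_less m\<close> means that the
  exponents of \<open>m\<close> read along the word decrease weakly, and strictly at descents.
\<close>

definition part_less :: "(nat \<Rightarrow>\<^sub>0 nat) \<Rightarrow> nat \<Rightarrow> nat \<Rightarrow> bool" where
  "part_less m a b \<longleftrightarrow> Poly_Mapping.lookup m b < Poly_Mapping.lookup m a
     \<or> Poly_Mapping.lookup m a = Poly_Mapping.lookup m b \<and> a < b"

text \<open>The set \<open>A\<close> of admissible exponents distinguishes three uses:
  \<open>{k}\<close> for a single factor $F(k)$, \<open>{..M}\<close> for a finite product,
  \<open>UNIV\<close> for the limit.\<close>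

definition word_partition :: "nat set \<Rightarrow> nat list \<Rightarrow> (nat \<Rightarrow>\<^sub>0 nat) \<Rightarrow> bool" where
  "word_partition A w m \<longleftrightarrow> Poly_Mapping.keys m \<subseteq> set w \<and> Poly_Mapping.lookup m ` set w \<subseteq> A
     \<and> sorted_wrt (part_less m) w"

lift_definition partition_series :: "nat set \<Rightarrow> nat list \<Rightarrow> 'a :: comm_ring_1 mfps"
  is "\<lambda>A w m. if word_partition A w m then 1 else 0" .

lemma partition_series_in: "partition_series A w \<in> series_in (set w)"
  by (simp add: series_in_def partition_series.rep_eq word_partition_def)

lemma partition_series_Nil: "partition_series A [] = 1"
  by (rule mfps_eqI) (simp add: partition_series.rep_eq one_mfps.rep_eq word_partition_def)

text \<open>Since the letter sets are disjoint, a factorization of the monomial \<open>m\<close> can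
  only be the restriction of \<open>m\<close> to each of them. At most one pair contributes, and the
  coefficient is 0 or 1.\<close>

lemma mcoeff_partition_series_times:
  assumes "set u \<inter> set v = {}"
  shows "mcoeff (partition_series A u * partition_series B v) m =
    (if Poly_Mapping.keys m \<subseteq> set u \<union> set v
        \<and> Poly_Mapping.lookup m ` set u \<subseteq> A \<and> sorted_wrt (part_less m) u
        \<and> Poly_Mapping.lookup m ` set v \<subseteq> B \<and> sorted_wrt (part_less m) v then 1 else 0)"
proof -
  \<comment> \<open>The restriction of \<open>m\<close> to the letters of \<open>w\<close>, the only
    candidate for a factor.\<close>
  define r where "r w = (\<Sum>a\<in>set w. Poly_Mapping.single a (Poly_Mapping.lookup m a))" for w
  have r: "Poly_Mapping.lookup (r w) x = (if x \<in> set w then Poly_Mapping.lookup m x else 0)" for w x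
    by (simp add: r_def lookup_sum_single)
  have part: "word_partition C w a \<longleftrightarrow> Poly_Mapping.keys a \<subseteq> set w
      \<and> Poly_Mapping.lookup m ` set w \<subseteq> C \<and> sorted_wrt (part_less m) w"
    if "\<And>x. x \<in> set w \<Longrightarrow> Poly_Mapping.lookup a x = Poly_Mapping.lookup m x" for C w a
  proof -
    have "sorted_wrt (part_less a) w \<longleftrightarrow> sorted_wrt (part_less m) w"
      by (auto simp: sorted_wrt_iff_nth_less part_less_def that)
    moreover have "Poly_Mapping.lookup a ` set w = Poly_Mapping.lookup m ` set w"
      using that by (rule image_cong[OF refl])
    ultimately show ?thesis by (simp add: word_partition_def)
  qed
  let ?Q = "Poly_Mapping.keys m \<subseteq> set u \<union> set v
        \<and> Poly_Mapping.lookup m ` set u \<subseteq> A \<and> sorted_wrt (part_less m) u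
        \<and> Poly_Mapping.lookup m ` set v \<subseteq> B \<and> sorted_wrt (part_less m) v"
  have iff: "a + b = m \<and> word_partition A u a \<and> word_partition B v b
      \<longleftrightarrow> a = r u \<and> b = r v \<and> ?Q" for a b
  proof (intro iffI; elim conjE)
    assume m: "a + b = m" and a: "word_partition A u a" and b: "word_partition B v b"
    have a0: "Poly_Mapping.lookup a x = 0" if "x \<notin> set u" for x
      using a that by (auto simp: word_partition_def in_keys_iff)
    have b0: "Poly_Mapping.lookup b x = 0" if "x \<notin> set v" for x
      using b that by (auto simp: word_partition_def in_keys_iff)
    have am: "Poly_Mapping.lookup a x = Poly_Mapping.lookup m x" if "x \<in> set u" for x
      using b0[of x] that assms by (auto simp: m[symmetric] lookup_add)
    have bm: "Poly_Mapping.lookup b x = Poly_Mapping.lookup m x" if "x \<in> set v" for x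
      using a0[of x] that assms by (auto simp: m[symmetric] lookup_add)
    have "a = r u" "b = r v"
      by (rule poly_mapping_eqI; simp add: r am bm a0 b0)+
    moreover have "Poly_Mapping.keys m \<subseteq> set u \<union> set v"
    proof
      fix x assume "x \<in> Poly_Mapping.keys m"
      then have "Poly_Mapping.lookup a x \<noteq> 0 \<or> Poly_Mapping.lookup b x \<noteq> 0"
        by (auto simp: m[symmetric] in_keys_iff lookup_add)
      then show "x \<in> set u \<union> set v" by (metis Un_iff a0 b0)
    qed
    ultimately show "a = r u \<and> b = r v \<and> ?Q"
      using a b part[OF am, of u A] part[OF bm, of v B] by simp
  next
    assume ab: "a = r u" "b = r v" and Q: "Poly_Mapping.keys m \<subseteq> set u \<union> set v"
      "Poly_Mapping.lookup m ` set u \<subseteq> A" "sorted_wrt (part_less m) u"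
      "Poly_Mapping.lookup m ` set v \<subseteq> B" "sorted_wrt (part_less m) v"
    have "a + b = m"
    proof (rule poly_mapping_eqI)
      fix x
      show "Poly_Mapping.lookup (a + b) x = Poly_Mapping.lookup m x"
        using assms Q(1) by (auto simp: ab lookup_add r in_keys_iff)
    qed
    moreover have "Poly_Mapping.keys a \<subseteq> set u" "Poly_Mapping.keys b \<subseteq> set v"
      by (auto simp: ab in_keys_iff r split: if_splits)
    ultimately show "a + b = m \<and> word_partition A u a \<and> word_partition B v b"
      using Q by (simp add: part ab r)
  qed
  have "mcoeff (partition_series A u * partition_series B v) m
      = (\<Sum>x\<in>{(a, b). a + b = m}.
           if word_partition A u (fst x) \<and> word_partition B v (snd x) then 1 else 0)"
    unfolding times_mfps.rep_eq by (intro sum.cong) (auto simp: partition_series.rep_eq)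
  also have "\<dots> = of_nat (card {x \<in> {(a, b). a + b = m}.
       word_partition A u (fst x) \<and> word_partition B v (snd x)})"
    by (subst sum.inter_filter[symmetric]) (auto simp: finite_antidiagonal_pm)
  also have "{x \<in> {(a, b). a + b = m}. word_partition A u (fst x) \<and> word_partition B v (snd x)}
      = {(a, b). a + b = m \<and> word_partition A u a \<and> word_partition B v b}"
    by auto
  also have "\<dots> = (if ?Q then {(r u, r v)} else {})"
    unfolding iff by auto
  also have "of_nat (card \<dots>) = (if ?Q then 1 else 0)" by simp
  finally show ?thesis .
qed

section \<open>Cutting off the block of maximal exponent\<close>

lemma word_partition_cut_unique:
  assumes "distinct w" "s \<le> length w"
    and "Poly_Mapping.lookup m ` set (take s w) \<subseteq> {Suc M}"
    and "Poly_Mapping.lookup m ` set (drop s w) \<subseteq> {..M}"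
  shows "s = length (takeWhile (\<lambda>a. Poly_Mapping.lookup m a = Suc M) w)"
proof -
  let ?P = "\<lambda>a. Poly_Mapping.lookup m a = Suc M"
  have "takeWhile ?P (take s w @ drop s w) = take s w @ takeWhile ?P (drop s w)"
    using assms(3) by (intro takeWhile_append2) auto
  also have "takeWhile ?P (drop s w) = []"
    using assms(4) by (cases "drop s w") (auto simp: subset_iff)
  finally show ?thesis using assms(2) by simp
qed

text \<open>Exponents decrease weakly along the word, so the first letter whose exponent is not
  \<open>Suc M\<close>, and every letter after it, has exponent at most \<open>M\<close>.\<close>

lemma word_partition_Suc_cut:
  assumes "word_partition {..Suc M} w m"
  defines "P \<equiv> \<lambda>a. Poly_Mapping.lookup m a = Suc M"
  shows "Poly_Mapping.lookup m ` set (takeWhile P w) \<subseteq> {Suc M}"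
    and "Poly_Mapping.lookup m ` set (dropWhile P w) \<subseteq> {..M}"
proof -
  show "Poly_Mapping.lookup m ` set (takeWhile P w) \<subseteq> {Suc M}"
    by (auto simp: P_def dest: set_takeWhileD)
  show "Poly_Mapping.lookup m ` set (dropWhile P w) \<subseteq> {..M}"
  proof (cases "dropWhile P w")
    case (Cons x xs)
    have "sorted_wrt (part_less m) (takeWhile P w @ dropWhile P w)"
      using assms(1) by (simp add: word_partition_def)
    then have sorted: "sorted_wrt (part_less m) (x # xs)"
      unfolding sorted_wrt_append Cons by blast
    have "x \<in> set w" by (metis Cons list.set_intros(1) set_dropWhileD)
    moreover have "\<not> P x" by (metis Cons dropWhile_eq_Cons_conv)
    ultimately have "Poly_Mapping.lookup m x \<le> M"
      using assms(1) by (fastforce simp: word_partition_def P_def le_Suc_eq)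
    then show ?thesis using sorted Cons by (auto simp: part_less_def)
  qed (simp only: list.set image_empty empty_subsetI)
qed

text \<open>For each monomial at most one cut contributes: the one after the maximal initial run of
  letters with exponent \<open>Suc M\<close>. The run may be empty, which is the summand
  \<open>s = 0\<close>.\<close>

lemma partition_series_Suc:
  assumes "distinct w"
  shows "partition_series {..Suc M} w
    = (\<Sum>s\<le>length w. partition_series {Suc M} (take s w) * partition_series {..M} (drop s w))"
proof (rule mfps_eqI)
  fix m
  let ?l = "Poly_Mapping.lookup m" and ?R = "part_less m"
  let ?P = "\<lambda>a. ?l a = Suc M"
  define s0 where "s0 = length (takeWhile ?P w)"
  define Q where "Q s \<longleftrightarrow> Poly_Mapping.keys m \<subseteq> set w
        \<and> ?l ` set (take s w) \<subseteq> {Suc M} \<and> sorted_wrt ?R (take s w)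
        \<and> ?l ` set (drop s w) \<subseteq> {..M} \<and> sorted_wrt ?R (drop s w)" for s
  have s0: "s0 \<le> length w" "take s0 w = takeWhile ?P w" "drop s0 w = dropWhile ?P w"
    by (simp_all add: s0_def length_takeWhile_le takeWhile_eq_take[symmetric] dropWhile_eq_drop[symmetric])
  have uniq: "s = s0" if "s \<le> length w" "Q s" for s
    unfolding s0_def using that by (intro word_partition_cut_unique assms) (auto simp: Q_def)
  have un: "set (take s w) \<union> set (drop s w) = set w" for s
    by (metis append_take_drop_id set_append)
  have "Q s0 \<longleftrightarrow> word_partition {..Suc M} w m"
  proof
    assume Q: "Q s0"
    \<comment> \<open>The exponent drops strictly across the cut, so \<open>part_less m\<close>
      holds there whether or not the cut is a descent.\<close>
    have "?l b < ?l a" if "a \<in> set (take s0 w)" "b \<in> set (drop s0 w)" for a b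
    proof -
      have "?l a = Suc M" "?l b \<le> M" using Q that unfolding Q_def by blast+
      then show ?thesis by simp
    qed
    then have "sorted_wrt ?R (take s0 w @ drop s0 w)"
      unfolding sorted_wrt_append using Q by (auto simp: Q_def part_less_def)
    moreover have "?l ` set w \<subseteq> {..Suc M}"
      unfolding un[of s0, symmetric] image_Un using Q by (fastforce simp: Q_def)
    ultimately show "word_partition {..Suc M} w m"
      using Q by (simp add: word_partition_def Q_def)
  next
    assume part: "word_partition {..Suc M} w m"
    then have "sorted_wrt ?R (take s0 w @ drop s0 w)" by (simp add: word_partition_def)
    then have "sorted_wrt ?R (take s0 w)" "sorted_wrt ?R (drop s0 w)"
      unfolding sorted_wrt_append by blast+
    then show "Q s0"
      using part word_partition_Suc_cut[OF part]
      by (simp add: Q_def word_partition_def s0)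
  qed
  moreover have "mcoeff (\<Sum>s\<le>length w. partition_series {Suc M} (take s w) * partition_series {..M} (drop s w)) m
      = (\<Sum>s\<le>length w. if Q s then 1 else (0 :: 'a))"
    unfolding mcoeff_sum_mfps Q_def
    by (intro sum.cong refl, subst mcoeff_partition_series_times)
       (use assms in \<open>auto simp: un set_take_disj_set_drop_if_distinct\<close>)
  moreover have "\<dots> = (\<Sum>s\<le>length w. if s = s0 then if Q s0 then 1 else 0 else 0)"
    using uniq by (intro sum.cong) auto
  ultimately show "mcoeff (partition_series {..Suc M} w) m
      = (mcoeff (\<Sum>s\<le>length w. partition_series {Suc M} (take s w) * partition_series {..M} (drop s w)) m :: 'a)"
    using s0(1) by (simp add: partition_series.rep_eq)
qed

section \<open>Standardization\<close>

lemma length_perms: "p \<in> perms n \<Longrightarrow> length p = n"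
  using distinct_card[of p] by (auto simp: permutations_of_set_def)

text \<open>Makes the definite description of \<open>st\<close> usable: \<open>st w\<close> is the
  word of ranks of the letters, so reading off the letters of those ranks recovers
  \<open>w\<close>.\<close>

lemma map_sort_st:
  assumes "distinct w"
  shows "map (letter (sort w)) (st w) = w"
    and "st w \<in> perms (length w)"
    and "\<And>i j. i < length w \<Longrightarrow> j < length w \<Longrightarrow> st w ! i < st w ! j \<longleftrightarrow> w ! i < w ! j"
proof -
  let ?n = "length w" and ?f = "letter (sort w)"
  define I where "I = {1..?n}"
  have f_less: "?f i < ?f j" if "i \<in> I" "j \<in> I" "i < j" for i j
  proof -
    have "sorted_wrt (<) (sort w)" using assms by (simp add: strict_sorted_iff)
    then show ?thesis
      using that sorted_wrt_nth_less[of "(<)" "sort w" "i - 1" "j - 1"]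
      by (simp add: letter_def I_def)
  qed
  have f_iff: "?f i < ?f j \<longleftrightarrow> i < j" if "i \<in> I" "j \<in> I" for i j
    using f_less[of i j] f_less[of j i] that by (metis less_asym linorder_neqE_nat)
  have "inj_on ?f I"
    by (rule inj_onI) (metis f_less less_irrefl linorder_neqE_nat)
  moreover have "?f ` I = set w"
  proof -
    have "?f ` (Suc ` {..<?n}) = (\<lambda>i. sort w ! i) ` {..<length (sort w)}"
      by (simp add: image_image letter_def)
    also have "\<dots> = set w"
      unfolding set_sort[of "\<lambda>x. x" w, symmetric] by (auto simp: set_conv_nth simp del: set_sort)
    finally show ?thesis by (simp add: I_def image_Suc_lessThan)
  qed
  ultimately have bij: "bij_betw ?f I (set w)" by (simp add: bij_betw_def)
  \<comment> \<open>\<open>g\<close> sends a letter to its rank; \<open>map g w\<close> satisfies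
    the characterization of \<open>st w\<close> and equals it by uniqueness.\<close>
  define g where "g = inv_into I ?f"
  have g: "g a \<in> I" "?f (g a) = a" if "a \<in> set w" for a
    using that bij by (auto simp: g_def bij_betw_def inv_into_into f_inv_into_f)
  have gbij: "bij_betw g (set w) I" unfolding g_def using bij by (rule bij_betw_inv_into)
  have g_iff: "g a < g b \<longleftrightarrow> a < b" if "a \<in> set w" "b \<in> set w" for a b
    using f_iff[OF g(1) g(1)] g(2) that by metis
  let ?q = "map g w"
  have q: "?q \<in> perms ?n"
    using gbij assms by (auto simp: permutations_of_set_def distinct_map bij_betw_def I_def)
  have "letter ?q i \<le> letter ?q j \<longleftrightarrow> letter w i \<le> letter w j"
    if "i \<in> {1..?n}" "j \<in> {1..?n}" for i j
  proof -
    have "i - 1 < ?n" "j - 1 < ?n" using that by auto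
    then show ?thesis using g_iff[of "letter w j" "letter w i"]
      by (simp add: letter_def linorder_not_less[symmetric])
  qed
  then have st: "st w = ?q"
    unfolding st_def using q by (intro the1_equality[OF st_exists_unique[OF assms]]) blast
  show "map ?f (st w) = w" unfolding st by (simp add: g(2) map_idI)
  show "st w \<in> perms ?n" unfolding st by (rule q)
  show "st w ! i < st w ! j \<longleftrightarrow> w ! i < w ! j" if "i < ?n" "j < ?n" for i j
    using that by (simp add: st g_iff)
qed

text \<open>Substitution renames the i-th variable to the i-th smallest letter. A word partition
  depends on the letters only through their relative order and exponents, and standardization
  preserves both.\<close>

lemma at_word_partition_series:
  assumes "distinct w"
  shows "at_word (partition_series A (st w)) w = partition_series A w"
proof (rule mfps_eqI)
  fix m
  let ?n = "length w"
  \<comment> \<open>The exponent vector that \<open>at_word\<close> looks up: \<open>m\<close>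
    pulled back along rank to letter.\<close>
  define r :: "nat \<Rightarrow>\<^sub>0 nat" where "r = (\<Sum>i = 1..?n. Poly_Mapping.single i (Poly_Mapping.lookup m (letter (sort w) i)))"
  have at_word: "mcoeff (at_word f w) m = (if Poly_Mapping.keys m \<subseteq> set w then mcoeff f r else 0)"
    for f :: "'a mfps"
    by (simp only: at_word.rep_eq r_def)
  have r: "Poly_Mapping.lookup r k = (if k \<in> {1..?n} then Poly_Mapping.lookup m (letter (sort w) k) else 0)" for k
    by (simp add: r_def lookup_sum_single)
  note st = map_sort_st[OF assms]
  have set_st: "set (st w) = {1..?n}" using st(2) by (simp add: permutations_of_set_def)
  have len: "length (st w) = ?n" using st(2) by (rule length_perms)
  have r_st: "Poly_Mapping.lookup r (st w ! i) = Poly_Mapping.lookup m (w ! i)" if "i < ?n" for i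
  proof -
    have "st w ! i \<in> {1..?n}" using that len set_st by (metis nth_mem)
    moreover have "letter (sort w) (st w ! i) = w ! i" using st(1) that len by (metis nth_map)
    ultimately show ?thesis by (simp add: r)
  qed
  have "sorted_wrt (part_less r) (st w) \<longleftrightarrow> sorted_wrt (part_less m) w"
    by (auto simp: sorted_wrt_iff_nth_less len part_less_def r_st st(3))
  moreover have "Poly_Mapping.lookup r ` set (st w) = Poly_Mapping.lookup m ` set w"
  proof -
    have "map (Poly_Mapping.lookup r) (st w) = map (Poly_Mapping.lookup m) w"
      by (rule nth_equalityI) (simp_all add: len r_st)
    then show ?thesis by (metis list.set_map)
  qed
  moreover have "Poly_Mapping.keys r \<subseteq> set (st w)"
    by (auto simp: set_st in_keys_iff r split: if_splits)
  ultimately show "mcoeff (at_word (partition_series A (st w)) w) m = (mcoeff (partition_series A w) m :: 'a)"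
    by (auto simp: at_word partition_series.rep_eq word_partition_def)
qed

text \<open>Once the cut \<open>s\<close> is fixed, \<sigma> and \<tau> are forced to be the
  standardizations of prefix and suffix, so the inner double sum has one surviving term.\<close>

lemma star_perm:
  assumes "w \<in> perms n"
  shows "(F \<star> G) w = (\<Sum>s\<le>length w. at_word (F (st (take s w))) (take s w)
                                       * at_word (G (st (drop s w))) (drop s w))"
  unfolding star_def
proof (intro sum.cong refl)
  fix s assume "s \<in> {..length w}"
  then have s: "s \<le> length w" by simp
  have w: "distinct w" using assms by (simp add: permutations_of_set_def)
  have n: "length w = n" using assms by (rule length_perms)
  let ?t = "at_word (F (st (take s w))) (take s w) * at_word (G (st (drop s w))) (drop s w)"
  have mem: "st (take s w) \<in> perms s" "st (drop s w) \<in> perms (length w - s)"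
    using map_sort_st(2)[of "take s w"] map_sort_st(2)[of "drop s w"] w s by (simp_all add: min_absorb2)
  have "(\<Sum>\<sigma>\<in>perms s. \<Sum>\<tau>\<in>perms (length w - s).
      if w \<in> star_words \<sigma> \<tau> then at_word (F \<sigma>) (take s w) * at_word (G \<tau>) (drop s w) else 0)
    = (\<Sum>\<sigma>\<in>perms s. if \<sigma> = st (take s w) then
        \<Sum>\<tau>\<in>perms (length w - s). if \<tau> = st (drop s w) then ?t else 0 else 0)"
  proof (intro sum.cong refl)
    fix \<sigma> assume \<sigma>: "\<sigma> \<in> perms s"
    have "w \<in> star_words \<sigma> \<tau> \<longleftrightarrow> \<sigma> = st (take s w) \<and> \<tau> = st (drop s w)"
      if "\<tau> \<in> perms (length w - s)" for \<tau>
      using length_perms[OF \<sigma>] length_perms[OF that] s assms n by (auto simp: star_words_def)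
    then show "(\<Sum>\<tau>\<in>perms (length w - s).
        if w \<in> star_words \<sigma> \<tau> then at_word (F \<sigma>) (take s w) * at_word (G \<tau>) (drop s w) else 0)
      = (if \<sigma> = st (take s w) then
          \<Sum>\<tau>\<in>perms (length w - s). if \<tau> = st (drop s w) then ?t else 0 else 0)"
      by (auto intro!: sum.cong)
  qed
  also have "\<dots> = ?t" using mem by simp
  finally show "(\<Sum>\<sigma>\<in>perms s. \<Sum>\<tau>\<in>perms (length w - s).
      if w \<in> star_words \<sigma> \<tau> then at_word (F \<sigma>) (take s w) * at_word (G \<tau>) (drop s w) else 0) = ?t" .
qed

lemma star_not_perm: "w \<notin> perms (length w) \<Longrightarrow> (F \<star> G) w = 0"
  unfolding star_def by (intro sum.neutral ballI) (auto simp: star_words_def length_perms)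

section \<open>The finite products\<close>

lemma Fm_not_perm: "w \<notin> perms (length w) \<Longrightarrow> Fm k w = 0"
proof -
  have "[1..<Suc n] \<in> perms n" for n
    by (auto simp: permutations_of_set_def simp del: upt_Suc)
  then show "Fm k w = 0" if "w \<notin> perms (length w)" using that by (metis Fm_def)
qed

text \<open>With all exponents equal to \<open>k\<close>, being sorted by \<open>part_less m\<close>
  means having no descent. Only the identity permutation qualifies, with a single monomial.\<close>

lemma Fm_perm:
  assumes "w \<in> perms n"
  shows "Fm k w = partition_series {k} w"
proof (rule mfps_eqI)
  fix m
  have n: "length w = n" using assms by (rule length_perms)
  have w: "set w = {1..n}" "distinct w" using assms by (simp_all add: permutations_of_set_def)
  have sorted: "w = [1..<Suc n] \<longleftrightarrow> sorted_wrt (<) w"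
  proof
    assume "sorted_wrt (<) w"
    moreover have "set w = set [1..<Suc n]"
      by (simp only: w(1) set_upt atLeastLessThanSuc_atLeastAtMost)
    ultimately show "w = [1..<Suc n]"
      by (intro strict_sorted_equal sorted_wrt_upt)
  qed (use strict_sorted_iff sorted_upt distinct_upt in metis)
  define e where "e = (\<Sum>i = 1..n. Poly_Mapping.single i k)"
  have e: "Poly_Mapping.lookup e i = (if i \<in> {1..n} then k else 0)" for i
    by (simp add: e_def lookup_sum_single)
  have m: "m = e \<longleftrightarrow> Poly_Mapping.keys m \<subseteq> {1..n} \<and> Poly_Mapping.lookup m ` {1..n} \<subseteq> {k}"
  proof
    assume "Poly_Mapping.keys m \<subseteq> {1..n} \<and> Poly_Mapping.lookup m ` {1..n} \<subseteq> {k}"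
    then show "m = e"
      by (intro poly_mapping_eqI) (fastforce simp: e in_keys_iff image_subset_iff subset_iff)
  qed (auto simp: e in_keys_iff split: if_splits)
  have less: "sorted_wrt (part_less m) w \<longleftrightarrow> sorted_wrt (<) w" if "m = e"
  proof -
    have "part_less m a b \<longleftrightarrow> a < b" if "a \<in> set w" "b \<in> set w" for a b
      using that unfolding part_less_def \<open>m = e\<close> e w(1) by simp
    then show ?thesis by (metis sorted_wrt_mono_rel)
  qed
  have "mcoeff (Fm k w) m = (if w = [1..<Suc n] \<and> m = e then 1 else (0 :: 'a))"
    by (auto simp: Fm_def n X_power mono_series_prod mcoeff_mono_series e_def zero_mfps.rep_eq
             simp del: upt_Suc)
  also have "w = [1..<Suc n] \<and> m = e \<longleftrightarrow> word_partition {k} w m"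
    unfolding word_partition_def w(1) using sorted m less by blast
  finally show "mcoeff (Fm k w) m = (mcoeff (partition_series {k} w) m :: 'a)"
    by (simp add: partition_series.rep_eq)
qed

lemma star_partial_Fm_not_perm: "w \<notin> perms (length w) \<Longrightarrow> star_partial Fm M w = 0"
  by (cases M) (simp_all add: Fm_not_perm star_not_perm)

text \<open>The new factor stands on the left, so it supplies the initial block with exponent
  \<open>Suc M\<close>; this is the recursion of \<open>partition_series_Suc\<close>.\<close>

lemma star_partial_Fm_perm:
  assumes "w \<in> perms n"
  shows "star_partial Fm M w = partition_series {..M} w"
  using assms
\<comment> \<open>The induction hypothesis is applied to the standardized suffixes of
  \<open>w\<close>, hence to other permutations of other sizes.\<close>
proof (induction M arbitrary: w n)
  case 0
  then show ?case by (simp add: Fm_perm)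
next
  case (Suc M)
  have w: "distinct w" using Suc.prems by (simp add: permutations_of_set_def)
  have st: "st v \<in> perms (length v)" if "distinct v" for v
    using that by (rule map_sort_st(2))
  have "star_partial Fm (Suc M) w = (\<Sum>s\<le>length w.
      at_word (Fm (Suc M) (st (take s w))) (take s w)
      * at_word (star_partial Fm M (st (drop s w))) (drop s w) :: 'a mfps)"
    using star_perm[OF Suc.prems] by simp
  also have "\<dots> = (\<Sum>s\<le>length w. partition_series {Suc M} (take s w) * partition_series {..M} (drop s w))"
    using w by (intro sum.cong refl)
      (simp add: Fm_perm[OF st] Suc.IH[OF st] at_word_partition_series)
  also have "\<dots> = partition_series {..Suc M} w"
    using w by (rule partition_series_Suc[symmetric])
  finally show ?case .
qed

section \<open>The limit\<close>

text \<open>Lowering all exponents on the word by one keeps their comparisons; positivity ensures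
  that the truncated subtraction is a genuine one.\<close>

lemma word_partition_shift:
  assumes "\<forall>a\<in>set w. 0 < Poly_Mapping.lookup m a"
  shows "word_partition UNIV w (m - (\<Sum>a\<in>set w. Poly_Mapping.single a 1)) \<longleftrightarrow> word_partition UNIV w m"
proof -
  define e where "e = (\<Sum>a\<in>set w. Poly_Mapping.single a (1 :: nat))"
  have l: "Poly_Mapping.lookup (m - e) x = Poly_Mapping.lookup m x - (if x \<in> set w then 1 else 0)" for x
    by (simp add: e_def lookup_minus lookup_sum_single)
  have pos: "0 < Poly_Mapping.lookup m (w ! i)" if "i < length w" for i
    using assms that by simp
  have "part_less (m - e) (w ! i) (w ! j) \<longleftrightarrow> part_less m (w ! i) (w ! j)"
    if "i < length w" "j < length w" for i j
    using pos[of i] pos[of j] that by (auto simp: part_less_def l)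
  then have "sorted_wrt (part_less (m - e)) w \<longleftrightarrow> sorted_wrt (part_less m) w"
    by (auto simp: sorted_wrt_iff_nth_less)
  moreover have "Poly_Mapping.keys (m - e) \<subseteq> set w \<longleftrightarrow> Poly_Mapping.keys m \<subseteq> set w"
    by (auto simp: subset_iff in_keys_iff l split: if_splits)
  ultimately show ?thesis unfolding e_def by (simp add: word_partition_def)
qed

text \<open>
  Dividing by \<open>1 - (\<Prod>k\<in>set w. X k)\<close> amounts to adding a constant to all exponents, so it suffices to
  consider the partitions in which the exponent of the last letter vanishes.
\<close>

lemma partition_series_snoc:
  assumes "distinct (v @ [a])"
  shows "partition_series UNIV (v @ [a]) * (1 - (\<Prod>k = 1..length (v @ [a]). X (letter (v @ [a]) k)))
       = (if v \<noteq> [] \<and> a < last v then \<Prod>k = 1..length v. X (letter v k) else 1)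
         * partition_series UNIV v"
proof -
  let ?w = "v @ [a]"
  define e :: "nat list \<Rightarrow> nat \<Rightarrow>\<^sub>0 nat" where "e u = (\<Sum>b\<in>set u. Poly_Mapping.single b (1 :: nat))" for u
  have e: "(\<forall>x. Poly_Mapping.lookup (e u) x \<le> Poly_Mapping.lookup m x)
      \<longleftrightarrow> (\<forall>x\<in>set u. 0 < Poly_Mapping.lookup m x)" for u m
    by (auto simp: e_def lookup_sum_single Suc_le_eq)
  \<comment> \<open>Multiplying by the product of all letters raises every exponent by one, which
    selects the partitions with all exponents positive.\<close>
  have mc: "mcoeff (mono_series (e u) * partition_series UNIV u) m
      = (if (\<forall>x\<in>set u. 0 < Poly_Mapping.lookup m x) \<and> word_partition UNIV u m then 1 else 0 :: 'a)"
    for u m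
  proof -
    have "word_partition UNIV u (m - e u) \<longleftrightarrow> word_partition UNIV u m"
      if "\<forall>x\<in>set u. 0 < Poly_Mapping.lookup m x"
      unfolding e_def using that by (rule word_partition_shift)
    then show ?thesis unfolding mcoeff_mono_series_times e partition_series.rep_eq by auto
  qed
  have last_less: "b = last v \<or> part_less m b (last v)"
    if "sorted_wrt (part_less m) v" "b \<in> set v" for b m
  proof -
    have "v = butlast v @ [last v]" using that(2) by (cases v rule: rev_cases) auto
    then show ?thesis using that
      by (metis Un_iff empty_iff insert_iff list.set(1) list.simps(15) set_append sorted_wrt_append)
  qed
  \<comment> \<open>If \<open>a\<close> has exponent 0, each letter \<open>b\<close> before it needs
    a positive exponent or \<open>b < a\<close>. By sortedness of \<open>v\<close> this reduces to
    comparing \<open>a\<close> with the last letter of \<open>v\<close>.\<close>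
  have step: "word_partition UNIV ?w m \<and> Poly_Mapping.lookup m a = 0
      \<longleftrightarrow> word_partition UNIV v m
          \<and> (v \<noteq> [] \<and> a < last v \<longrightarrow> (\<forall>x\<in>set v. 0 < Poly_Mapping.lookup m x))" for m
  proof -
    have keys: "Poly_Mapping.keys m \<subseteq> set ?w \<and> Poly_Mapping.lookup m a = 0
        \<longleftrightarrow> Poly_Mapping.keys m \<subseteq> set v"
    proof -
      have "Poly_Mapping.lookup m a = 0 \<longleftrightarrow> a \<notin> Poly_Mapping.keys m" by (simp add: in_keys_iff)
      then show ?thesis using assms by auto
    qed
    have "(\<forall>b\<in>set v. 0 < Poly_Mapping.lookup m b \<or> b < a)
        \<longleftrightarrow> (v \<noteq> [] \<and> a < last v \<longrightarrow> (\<forall>x\<in>set v. 0 < Poly_Mapping.lookup m x))"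
      if "sorted_wrt (part_less m) v"
    proof (cases "v \<noteq> [] \<and> a < last v")
      case True
      then have "last v \<in> set v" by simp
      \<comment> \<open>Here \<open>a < last v\<close> forces a positive exponent on
        \<open>last v\<close>, which has the least exponent in \<open>v\<close>.\<close>
      then show ?thesis using True last_less[OF that] by (fastforce simp: part_less_def)
    next
      case False
      have "last v < a" if "v \<noteq> []"
      proof -
        have "last v \<noteq> a" using assms last_in_set[OF that] by auto
        then show ?thesis using False that by simp
      qed
      \<comment> \<open>A letter \<open>b\<close> of exponent 0 other than \<open>last v\<close>
        ties with \<open>last v\<close>, so \<open>b < last v < a\<close>.\<close>
      then have "0 < Poly_Mapping.lookup m b \<or> b < a" if "b \<in> set v" for b
        using last_less[OF \<open>sorted_wrt (part_less m) v\<close> that] that by (fastforce simp: part_less_def)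
      then show ?thesis using False by blast
    qed
    moreover have "sorted_wrt (part_less m) ?w \<longleftrightarrow> sorted_wrt (part_less m) v
         \<and> (\<forall>b\<in>set v. 0 < Poly_Mapping.lookup m b \<or> b < a)" if "Poly_Mapping.lookup m a = 0"
      using that by (auto simp: sorted_wrt_append part_less_def)
    ultimately show ?thesis
      using keys assms unfolding word_partition_def by auto
  qed
  \<comment> \<open>The last letter carries the least exponent, so all exponents are positive
    exactly when that of \<open>a\<close> is.\<close>
  have zero: "Poly_Mapping.lookup m a = 0 \<longleftrightarrow> \<not> (\<forall>x\<in>set ?w. 0 < Poly_Mapping.lookup m x)"
    if "word_partition UNIV ?w m" for m
    using that by (auto simp: word_partition_def sorted_wrt_append part_less_def)
  have prodw: "(\<Prod>k = 1..length u. X (letter u k)) = (mono_series (e u) :: 'a mfps)" if "distinct u" for u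
    unfolding e_def using that by (rule prod_letters)
  have "distinct v" using assms by simp
  have "mcoeff (partition_series UNIV ?w * (1 - mono_series (e ?w))) m
      = mcoeff ((if v \<noteq> [] \<and> a < last v then mono_series (e v) else 1) * partition_series UNIV v :: 'a mfps) m"
    for m
  proof -
    have "mcoeff (partition_series UNIV ?w * (1 - mono_series (e ?w))) m
        = mcoeff (partition_series UNIV ?w) m - (mcoeff (mono_series (e ?w) * partition_series UNIV ?w) m :: 'a)"
      by (simp add: right_diff_distrib minus_mfps.rep_eq mult.commute)
    also have "\<dots> = (if word_partition UNIV ?w m \<and> Poly_Mapping.lookup m a = 0 then 1 else 0)"
      unfolding mc partition_series.rep_eq using zero[of m] by auto
    also have "\<dots> = mcoeff ((if v \<noteq> [] \<and> a < last v then mono_series (e v) else 1) * partition_series UNIV v) m"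
      unfolding step by (auto simp: mc partition_series.rep_eq)
    finally show ?thesis .
  qed
  then show ?thesis
    unfolding prodw[OF assms] prodw[OF \<open>distinct v\<close>] by (intro mfps_eqI)
qed

section \<open>Closed form of the limit coefficients\<close>

lemma descents_snoc:
  "descents (v @ [a]) = descents v \<union> (if v \<noteq> [] \<and> a < last v then {length v} else {})"
proof (cases "v = []")
  case False
  have old: "letter (v @ [a]) j = letter v j" if "1 \<le> j" "j \<le> length v" for j
    using that by (auto simp: letter_def nth_append)
  have last: "letter (v @ [a]) (length v) = last v" "letter (v @ [a]) (length v + 1) = a"
    using False by (auto simp: letter_def nth_append last_conv_nth)
  show ?thesis
  proof (rule set_eqI)
    fix j
    consider "1 \<le> j" "j \<le> length v - 1" | "j = length v" | "j < 1 \<or> length v < j" by linarith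
    then show "j \<in> descents (v @ [a])
        \<longleftrightarrow> j \<in> descents v \<union> (if v \<noteq> [] \<and> a < last v then {length v} else {})"
    proof cases
      case 1
      then have "letter (v @ [a]) j = letter v j" "letter (v @ [a]) (j + 1) = letter v (j + 1)"
        by (intro old; linarith)+
      then show ?thesis using 1 by (auto simp: descents_def)
    next
      case 2
      have "length v - 1 < length v" "1 \<le> length v" using False by (simp_all add: Suc_le_eq)
      then have "\<not> length v \<le> length v - 1" by linarith
      then show ?thesis using 2 False last \<open>1 \<le> length v\<close> by (simp add: descents_def)
    next
      case 3
      then show ?thesis using False by (auto simp: descents_def)
    qed
  qed
qed (auto simp: descents_def)

text \<open>Each appended letter accounts for one denominator factor and, if it creates a descent,
  for one numerator factor. Clearing denominators keeps the induction inside the ring.\<close>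

lemma partition_series_denominator:
  assumes "distinct w"
  shows "partition_series UNIV w * (\<Prod>i = 1..length w. 1 - (\<Prod>k = 1..i. X (letter w k)))
       = (\<Prod>j\<in>descents w. \<Prod>k = 1..j. X (letter w k))"
  using assms
proof (induction w rule: rev_induct)
  case Nil
  then show ?case by (simp add: partition_series_Nil descents_def)
next
  case (snoc a v)
  let ?w = "v @ [a]"
  define p where "p u i = (\<Prod>k = 1..i. X (letter u k) :: 'a mfps)" for u i
  have p: "p ?w i = p v i" if "i \<le> length v" for i
    unfolding p_def using that by (intro prod.cong) (auto simp: letter_def nth_append)
  have desc: "j < length v" if "j \<in> descents v" for j using that by (auto simp: descents_def)
  have fin: "finite (descents v)" "length v \<notin> descents v"
    using desc by (auto simp: descents_def)
  have "(\<Prod>i = 1..length ?w. 1 - p ?w i) = (1 - p ?w (length ?w)) * (\<Prod>i = 1..length v. 1 - p ?w i)"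
    by (simp add: mult.commute)
  also have "(\<Prod>i = 1..length v. 1 - p ?w i) = (\<Prod>i = 1..length v. 1 - p v i)"
    by (intro prod.cong refl) (simp add: p)
  finally have "partition_series UNIV ?w * (\<Prod>i = 1..length ?w. 1 - p ?w i)
      = (partition_series UNIV ?w * (1 - p ?w (length ?w))) * (\<Prod>i = 1..length v. 1 - p v i)"
    by (simp add: mult.assoc)
  also have "\<dots> = (if v \<noteq> [] \<and> a < last v then p v (length v) else 1)
      * (partition_series UNIV v * (\<Prod>i = 1..length v. 1 - p v i))"
    unfolding p_def partition_series_snoc[OF snoc.prems] by (simp add: mult.assoc)
  also have "partition_series UNIV v * (\<Prod>i = 1..length v. 1 - p v i) = (\<Prod>j\<in>descents v. p v j)"
    unfolding p_def using snoc by simp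
  also have "\<dots> = (\<Prod>j\<in>descents v. p ?w j)"
    by (intro prod.cong refl) (simp add: p desc less_imp_le)
  also have "(if v \<noteq> [] \<and> a < last v then p v (length v) else 1) * \<dots> = (\<Prod>j\<in>descents ?w. p ?w j)"
    unfolding descents_snoc using desc fin by (auto simp: p)
  finally show ?case by (simp only: p_def)
qed

lemma mcoeff_times_0: "mcoeff (f * g) 0 = mcoeff f 0 * mcoeff g 0"
proof -
  have "{(a, b). a + b = (0 :: nat \<Rightarrow>\<^sub>0 nat)} = {(0, 0)}"
    by (auto simp: poly_mapping_eq_iff lookup_add fun_eq_iff)
  then show ?thesis by (simp add: times_mfps.rep_eq)
qed

lemma mcoeff_prod_0: "mcoeff (\<Prod>i\<in>A. f i) 0 = (\<Prod>i\<in>A. mcoeff (f i) 0)"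
  by (induction A rule: infinite_finite_induct) (simp_all add: mcoeff_times_0 one_mfps.rep_eq)

lemma Theta_perm:
  assumes "w \<in> perms n"
  shows "Theta w = partition_series UNIV w"
proof -
  let ?D = "\<Prod>i = 1..length w. 1 - (\<Prod>k = 1..i. X (letter w k)) :: 'a mfps"
  have w: "distinct w" "w \<in> perms (length w)"
    using assms length_perms[OF assms] by (auto simp: permutations_of_set_def)
  have "mcoeff (X k) 0 = (0 :: 'a)" for k
    by (auto simp: X.rep_eq poly_mapping_eq_iff fun_eq_iff lookup_single when_def)
  \<comment> \<open>Every prefix product has constant term 0, so the denominator has constant term 1
    and is invertible.\<close>
  then have "mcoeff ?D 0 = 1"
    by (auto simp: mcoeff_prod_0 minus_mfps.rep_eq one_mfps.rep_eq intro!: prod.neutral)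
  then have D: "?D * inverse ?D = 1" by (intro mult_inverse_mfps) simp
  have "Theta w = partition_series UNIV w * ?D * inverse ?D"
    using w by (simp only: Theta_def if_True divide_mfps_def partition_series_denominator)
  then show ?thesis by (simp only: mult.assoc D mult_1_right)
qed

section \<open>Membership in the algebra and convergence\<close>

lemma perm_algebraI:
  assumes "\<And>n w. w \<in> perms n \<Longrightarrow> F w = partition_series A w"
    and "\<And>w. w \<notin> perms (length w) \<Longrightarrow> F w = 0"
  shows "F \<in> perm_algebra"
proof -
  have "F w \<in> series_in {1..n}" if "w \<in> perms n" for n w
    using assms(1)[OF that] partition_series_in[of A w] that by (simp add: permutations_of_set_def)
  then show ?thesis using assms(2) by (auto simp: perm_algebra_def)
qed

theorem theorem5p2:
  shows "(Theta :: 'a :: field_char_0 perm_series) \<in> perm_algebra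
       \<and> (\<forall>m. (Fm m :: 'a perm_series) \<in> perm_algebra)
       \<and> Fm has_star_prod (Theta :: 'a perm_series)"
proof (intro conjI allI)
  have Theta_0: "Theta w = (0 :: 'a mfps)" if "w \<notin> perms (length w)" for w
    using that by (simp add: Theta_def)
  show "(Theta :: 'a perm_series) \<in> perm_algebra"
    by (rule perm_algebraI[OF Theta_perm Theta_0])
  show "(Fm m :: 'a perm_series) \<in> perm_algebra" for m
    by (rule perm_algebraI[OF Fm_perm Fm_not_perm])
  show "Fm has_star_prod (Theta :: 'a perm_series)"
    unfolding has_star_prod_def
  proof (intro allI)
    fix w m
    show "eventually (\<lambda>M. mcoeff (star_partial Fm M w) m = (mcoeff (Theta w) m :: 'a)) sequentially"
    proof (cases "w \<in> perms (length w)")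
      case True
      \<comment> \<open>Once \<open>M\<close> reaches the largest exponent of \<open>m\<close> on
        \<open>w\<close>, the bound is vacuous and the coefficient is stable. Inserting 0 keeps
        \<open>Max\<close> meaningful for the empty word.\<close>
      have "word_partition {..M} w m \<longleftrightarrow> word_partition UNIV w m"
        if "Max (insert 0 (Poly_Mapping.lookup m ` set w)) \<le> M" for M
        using that by (auto simp: word_partition_def)
      then show ?thesis
        unfolding star_partial_Fm_perm[OF True] Theta_perm[OF True] partition_series.rep_eq
        by (intro eventually_sequentiallyI[of "Max (insert 0 (Poly_Mapping.lookup m ` set w))"]) simp
    next
      case False
      then show ?thesis by (simp add: star_partial_Fm_not_perm Theta_0)
    qed
  qed
qed

end
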